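(* Consider a two-qubit system with Hamiltonian $H=H_1\otimes\mathbf{I}+\mathbf{I}\otimes H_2$, where $H_l=\sum_{i=0}^1(E_l+i\alpha_l)|i\rangle\langle i|$ with $E_l\in\mathbb{R}$, $\alpha_l\ge 0$ for $l=1,2$. Then every separable two-qubit state $\rho$ satisfies $$\Delta_{1|2}\le\max\left\{\frac{\alpha_1-\alpha_2}{2},\,0\right\},$$ where $\Delta_{1|2}=W(\rho)-W_{[1]}(\rho_1)-E(\rho_2)+E_g^{2}$.
   Context: A state is a positive semidefinite trace-one operator; $\rho_1,\rho_2$ are the reduced states of $\rho$ on qubits 1 and 2. A state is separable if it is a convex combination of product states. The energy of a state $\sigma$ of a (sub)system with Hamiltonian $K$ is $E(\sigma)=\mathrm{Tr}[\sigma K]$. The ergotropy of $\sigma$ with respect to $K$ is $\mathrm{Tr}[\sigma K]-\min_U\mathrm{Tr}[U\sigma U^\dagger K]$, the minimum being over all unitaries $U$ on the corresponding Hilbert space. $W(\rho)$ is the ergotropy of $\rho$ with respect to $H$, $W_{[1]}(\rho_1)$ is the ergotropy of $\rho_1$ with respect to $H_1$, $E(\rho_2)=\mathrm{Tr}[\rho_2H_2]$, and $E_g^2=E_2$ is the ground-state energy of $H_2$. *)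

theory Defs
  imports "HOL-Analysis.Analysis"
begin

text \<open>Operators on a Hilbert space with orthonormal basis indexed by the finite type \<open>'n\<close>
  are matrices of type \<open>complex^'n^'n\<close>. A qubit is indexed by the two-element type \<open>2\<close>
  (with elements 0 and 1), and a bipartite system by the product type of the two index types.\<close>

definition dagger :: "complex^'n^'m \<Rightarrow> complex^'m^'n" where
  "dagger A = (\<chi> i j. cnj (A $ j $ i))"

definition unitary :: "complex^'n^'n \<Rightarrow> bool" where
  "unitary U \<longleftrightarrow> U ** dagger U = mat 1 \<and> dagger U ** U = mat 1"

definition pos_semidef :: "complex^'n^'n \<Rightarrow> bool" where
  "pos_semidef A \<longleftrightarrow> dagger A = A \<and> (\<forall>v. 0 \<le> Re (\<Sum>i\<in>UNIV. cnj (v $ i) * (A *v v) $ i))"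

definition state :: "complex^'n^'n \<Rightarrow> bool" where
  "state \<rho> \<longleftrightarrow> pos_semidef \<rho> \<and> trace \<rho> = 1"

definition tensor :: "complex^'a^'a \<Rightarrow> complex^'b^'b \<Rightarrow> complex^('a::finite \<times> 'b::finite)^('a \<times> 'b)"
    (infixl "\<otimes>" 75) where
  "A \<otimes> B = (\<chi> p q. A $ fst p $ fst q * B $ snd p $ snd q)"

definition reduced1 :: "complex^('a::finite \<times> 'b::finite)^('a \<times> 'b) \<Rightarrow> complex^'a^'a" where
  "reduced1 \<rho> = (\<chi> i j. \<Sum>k\<in>UNIV. \<rho> $ (i, k) $ (j, k))"

definition reduced2 :: "complex^('a::finite \<times> 'b::finite)^('a \<times> 'b) \<Rightarrow> complex^'b^'b" where
  "reduced2 \<rho> = (\<chi> i j. \<Sum>k\<in>UNIV. \<rho> $ (k, i) $ (k, j))"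

definition separable :: "complex^('a::finite \<times> 'b::finite)^('a \<times> 'b) \<Rightarrow> bool" where
  "separable \<rho> \<longleftrightarrow> \<rho> \<in> convex hull {\<sigma> \<otimes> \<tau> |\<sigma> \<tau>. state \<sigma> \<and> state \<tau>}"

text \<open>The trace below is real for Hermitian arguments, so taking the real part loses nothing.\<close>

definition energy :: "complex^'n^'n \<Rightarrow> complex^'n^'n \<Rightarrow> real" where
  "energy K \<sigma> = Re (trace (\<sigma> ** K))"

text \<open>The infimum is a minimum, see \<open>ergotropy_min_attained\<close>.\<close>

definition ergotropy :: "complex^'n^'n \<Rightarrow> complex^'n^'n \<Rightarrow> real" where
  "ergotropy K \<sigma> = energy K \<sigma> - (INF U\<in>{U. unitary U}. energy K (U ** \<sigma> ** dagger U))"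

definition ground_energy :: "complex^'n^'n \<Rightarrow> real" where
  "ground_energy K = Min {e. \<exists>v. v \<noteq> 0 \<and> K *v v = complex_of_real e *s v}"

definition ketbra :: "'n \<Rightarrow> 'n \<Rightarrow> complex^'n^'n" where
  "ketbra i j = (\<chi> a b. if a = i \<and> b = j then 1 else 0)"

definition qubit_hamiltonian :: "real \<Rightarrow> real \<Rightarrow> complex^2^2" where
  "qubit_hamiltonian E \<alpha> = (\<Sum>i::nat = 0..1. (E + real i * \<alpha>) *\<^sub>R ketbra (of_nat i) (of_nat i))"

definition total_hamiltonian ::
    "complex^'a^'a \<Rightarrow> complex^'b^'b \<Rightarrow> complex^('a::finite \<times> 'b::finite)^('a \<times> 'b)" where
  "total_hamiltonian H1 H2 = H1 \<otimes> mat 1 + mat 1 \<otimes> H2"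

definition Delta12 ::
    "complex^'a^'a \<Rightarrow> complex^'b^'b \<Rightarrow> complex^('a::finite \<times> 'b::finite)^('a \<times> 'b) \<Rightarrow> real" where
  "Delta12 H1 H2 \<rho> =
     ergotropy (total_hamiltonian H1 H2) \<rho> - ergotropy H1 (reduced1 \<rho>)
     - energy H2 (reduced2 \<rho>) + ground_energy H2"

lemma compact_unitary: "compact {U :: complex^'n^'n. unitary U}"
proof -
  have "closed {U :: complex^'n^'n. unitary U}"
    unfolding unitary_def dagger_def matrix_matrix_mult_def
    by (intro closed_Collect_conj closed_Collect_eq continuous_intros)
  moreover have "norm U \<le> (\<Sum>i\<in>(UNIV::'n set). \<Sum>j\<in>(UNIV::'n set). 1)"
    if "unitary U" for U :: "complex^'n^'n"
  proof -
    have entry: "norm (U $ i $ j) \<le> 1" for i j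
    proof -
      have "(\<Sum>k\<in>UNIV. U $ i $ k * cnj (U $ i $ k)) = (U ** dagger U) $ i $ i"
        by (simp add: matrix_matrix_mult_def dagger_def)
      also have "\<dots> = 1"
        using that by (simp add: unitary_def mat_def)
      finally have "Re (\<Sum>k\<in>UNIV. U $ i $ k * cnj (U $ i $ k)) = 1"
        by simp
      then have "(\<Sum>k\<in>UNIV. (norm (U $ i $ k))\<^sup>2) = 1"
        by (simp add: complex_mult_cnj cmod_power2)
      moreover have "(norm (U $ i $ j))\<^sup>2 \<le> (\<Sum>k\<in>UNIV. (norm (U $ i $ k))\<^sup>2)"
        by (rule member_le_sum) auto
      ultimately have "(norm (U $ i $ j))\<^sup>2 \<le> 1\<^sup>2"
        by simp
      then show ?thesis
        by (rule power2_le_imp_le) simp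
    qed
    have "norm U \<le> (\<Sum>i\<in>UNIV. norm (U $ i))"
      by (simp add: norm_vec_def L2_set_le_sum)
    also have "\<dots> \<le> (\<Sum>i\<in>UNIV. \<Sum>j\<in>UNIV. norm (U $ i $ j))"
      by (intro sum_mono) (simp add: norm_vec_def L2_set_le_sum)
    also have "\<dots> \<le> (\<Sum>i\<in>(UNIV::'n set). \<Sum>j\<in>(UNIV::'n set). 1)"
      by (intro sum_mono entry)
    finally show ?thesis .
  qed
  then have "bounded {U :: complex^'n^'n. unitary U}"
    unfolding bounded_iff by blast
  ultimately show ?thesis
    by (simp add: compact_eq_bounded_closed)
qed

lemma ergotropy_min_attained:
  obtains U where "unitary U"
    and "\<And>V. unitary V \<Longrightarrow> energy K (U ** \<sigma> ** dagger U) \<le> energy K (V ** \<sigma> ** dagger V)"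
    and "ergotropy K \<sigma> = energy K \<sigma> - energy K (U ** \<sigma> ** dagger U)"
proof -
  let ?f = "\<lambda>U. energy K (U ** \<sigma> ** dagger U)"
  have "continuous_on {U. unitary U} ?f"
    unfolding energy_def trace_def dagger_def matrix_matrix_mult_def
    by (simp, intro continuous_intros)
  moreover have "unitary (mat 1 :: complex^'n^'n)"
  proof -
    have "dagger (mat 1 :: complex^'n^'n) = mat 1"
      by (simp add: dagger_def mat_def vec_eq_iff)
    then show ?thesis
      by (simp add: unitary_def)
  qed
  ultimately obtain U where U: "unitary U" "\<And>V. unitary V \<Longrightarrow> ?f U \<le> ?f V"
    using continuous_attains_inf[OF compact_unitary, of ?f] by blast
  have "(INF V\<in>{V. unitary V}. ?f V) = ?f U"
    using U by (intro cInf_eq_minimum) auto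
  then show thesis
    using that[OF U] by (simp add: ergotropy_def)
qed

lemma ground_energy_qubit_hamiltonian:
  assumes "\<alpha> \<ge> 0"
  shows "ground_energy (qubit_hamiltonian E \<alpha>) = E"
proof -
  have H0: "(qubit_hamiltonian E \<alpha> *v v) $ 1 = of_real (E + \<alpha>) * v $ 1"
   and H1: "(qubit_hamiltonian E \<alpha> *v v) $ 2 = of_real E * v $ 2" for v
    unfolding qubit_hamiltonian_def ketbra_def matrix_vector_mult_def
    by (simp_all add: sum_2 scaleR_conv_of_real[where 'a = complex])
  have eq: "qubit_hamiltonian E \<alpha> *v v = of_real e *s v \<longleftrightarrow>
      of_real (E + \<alpha>) * v $ 1 = of_real e * v $ 1 \<and> of_real E * v $ 2 = of_real e * v $ 2" for v e
    by (simp only: vec_eq_iff forall_2 H0 H1 vector_smult_component)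
  have "{e. \<exists>v. v \<noteq> 0 \<and> qubit_hamiltonian E \<alpha> *v v = of_real e *s v} = {E, E + \<alpha>}"
  proof (intro equalityI subsetI)
    fix e assume "e \<in> {e. \<exists>v. v \<noteq> 0 \<and> qubit_hamiltonian E \<alpha> *v v = of_real e *s v}"
    then obtain v :: "complex^2" where v: "v \<noteq> 0" "of_real (E + \<alpha>) * v $ 1 = of_real e * v $ 1"
        "of_real E * v $ 2 = of_real e * v $ 2"
      unfolding eq by blast
    have "v $ 1 \<noteq> 0 \<or> v $ 2 \<noteq> 0"
      using v(1) by (simp add: vec_eq_iff forall_2)
    then have "complex_of_real (E + \<alpha>) = of_real e \<or> complex_of_real E = of_real e"
      using v(2,3) by (metis mult_right_cancel)
    then show "e \<in> {E, E + \<alpha>}"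
      unfolding of_real_eq_iff by blast
  next
    fix e assume "e \<in> {E, E + \<alpha>}"
    then consider "e = E" | "e = E + \<alpha>"
      by blast
    then show "e \<in> {e. \<exists>v. v \<noteq> 0 \<and> qubit_hamiltonian E \<alpha> *v v = of_real e *s v}"
    proof cases
      case 1
      have "axis 2 1 \<noteq> (0 :: complex^2)"
        by (simp add: axis_eq_0_iff)
      moreover have "qubit_hamiltonian E \<alpha> *v axis 2 1 = of_real e *s axis 2 1"
        unfolding eq using 1 by (simp add: axis_def)
      ultimately show ?thesis by blast
    next
      case 2
      have "axis 1 1 \<noteq> (0 :: complex^2)"
        by (simp add: axis_eq_0_iff)
      moreover have "qubit_hamiltonian E \<alpha> *v axis 1 1 = of_real e *s axis 1 1"
        unfolding eq using 2 by (simp add: axis_def)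
      ultimately show ?thesis by blast
    qed
  qed
  then show ?thesis
    using assms by (simp add: ground_energy_def)
qed

end

theory Submission imports Defs begin

text \<open>A separable \<open>\<rho>\<close> satisfies \<open>\<rho> \<le> \<rho>\<^sub>1 \<otimes> mat 1\<close> (reduction criterion), so every diagonal entry of
  \<open>U \<rho> U\<^sup>\<dagger>\<close> is at most the largest eigenvalue \<open>p\<close> of \<open>\<rho>\<^sub>1\<close>. With \<open>d\<^sub>i\<^sub>k\<close> the diagonal entries for an
  optimal \<open>U\<close>, the quantity \<open>\<Delta>\<close> is at most
  \<open>\<alpha>\<^sub>1 (1 - p) - \<alpha>\<^sub>1 (d\<^sub>1\<^sub>0 + d\<^sub>1\<^sub>1) - \<alpha>\<^sub>2 (d\<^sub>0\<^sub>1 + d\<^sub>1\<^sub>1)\<close>.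
  If \<open>\<alpha>\<^sub>1 \<le> \<alpha>\<^sub>2\<close>, the bound \<open>p \<ge> d\<^sub>0\<^sub>0\<close> makes this nonpositive; otherwise \<open>p \<ge> max d\<^sub>0\<^sub>0 d\<^sub>0\<^sub>1\<close> bounds it by
  \<open>(\<alpha>\<^sub>1 - \<alpha>\<^sub>2) min d\<^sub>0\<^sub>0 d\<^sub>0\<^sub>1\<close>, and that minimum is at most \<open>1 / 2\<close>.\<close>

section \<open>Sesquilinear forms and Cauchy-Schwarz for semidefinite matrices\<close>

definition sesq :: "complex^'n^'n \<Rightarrow> complex^'n \<Rightarrow> complex^'n \<Rightarrow> complex" where
  "sesq A u w = (\<Sum>i\<in>UNIV. \<Sum>j\<in>UNIV. cnj (u $ i) * A $ i $ j * w $ j)"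

lemma sesq_add_left: "sesq A (u + u') w = sesq A u w + sesq A u' w"
  by (simp add: sesq_def algebra_simps sum.distrib)

lemma sesq_add_right: "sesq A u (w + w') = sesq A u w + sesq A u w'"
  by (simp add: sesq_def algebra_simps sum.distrib)

lemma sesq_mult_left: "sesq A (c *s u) w = cnj c * sesq A u w"
  by (simp add: sesq_def sum_distrib_left mult.assoc)

lemma sesq_mult_right: "sesq A u (c *s w) = c * sesq A u w"
  by (simp add: sesq_def sum_distrib_left mult_ac)

lemmas sesq_linear = sesq_add_left sesq_add_right sesq_mult_left sesq_mult_right

lemma sesq_add_matrix: "sesq (A + B) u w = sesq A u w + sesq B u w"
  by (simp add: sesq_def algebra_simps sum.distrib)

lemma sesq_scaleR_matrix: "sesq (c *\<^sub>R A) u w = c *\<^sub>R sesq A u w"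
  by (simp add: sesq_def scaleR_sum_right)

lemma sesq_axis: "sesq A (axis i 1) (axis j 1) = A $ i $ j"
proof -
  have "sesq A (axis i 1) (axis j 1) = (\<Sum>a\<in>UNIV. \<Sum>b\<in>UNIV. if a = i then if b = j then A $ a $ b else 0 else 0)"
    unfolding sesq_def by (intro sum.cong refl) (auto simp: axis_def)
  also have "\<dots> = A $ i $ j"
    by (subst sum.swap) simp
  finally show ?thesis .
qed

lemma sesq_cnj:
  assumes "dagger A = A"
  shows "cnj (sesq A u w) = sesq A w u"
proof -
  have A: "cnj (A $ i $ j) = A $ j $ i" for i j
    using arg_cong[OF assms, of "\<lambda>B. B $ j $ i"] by (simp add: dagger_def)
  show ?thesis
    unfolding sesq_def cnj_sum by (subst sum.swap) (simp add: A mult_ac)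
qed

lemma pos_semidef_sesq:
  "pos_semidef A \<longleftrightarrow> dagger A = A \<and> (\<forall>v. 0 \<le> Re (sesq A v v))"
  by (simp add: pos_semidef_def sesq_def matrix_vector_mult_def sum_distrib_left mult.assoc)

text \<open>Positivity at \<open>u + x *s w\<close> for suitable \<open>x\<close> gives a
  nonnegative real quadratic in \<open>t\<close>. The form may be degenerate, so a vanishing
  \<open>sesq A w w\<close> needs its own case.\<close>

lemma pos_semidef_Cauchy_Schwarz:
  assumes "pos_semidef A"
  shows "(cmod (sesq A u w))\<^sup>2 \<le> Re (sesq A u u) * Re (sesq A w w)"
proof -
  define a b c where "a = Re (sesq A u u)" and "b = Re (sesq A w w)" and "c = sesq A u w"
  have c': "sesq A w u = cnj c"
    using sesq_cnj[of A u w] assms by (simp add: c_def pos_semidef_def)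
  have b: "0 \<le> b"
    using assms by (simp add: b_def pos_semidef_sesq)
  have cc: "of_real ((cmod c)\<^sup>2) = c * cnj c"
    by (rule complex_norm_square)
  have quad: "0 \<le> a - 2 * t * (cmod c)\<^sup>2 + t\<^sup>2 * (cmod c)\<^sup>2 * b" for t
  proof -
    \<comment> \<open>The factor \<open>cnj c\<close> makes the cross term \<open>x * c\<close>
      real, so only the real parameter \<open>t\<close> remains.\<close>
    define x where "x = - of_real t * cnj c"
    have "0 \<le> Re (sesq A (u + x *s w) (u + x *s w))"
      using assms by (simp add: pos_semidef_sesq)
    also have "sesq A (u + x *s w) (u + x *s w) =
        sesq A u u + x * c + cnj (x * c) + cnj x * x * sesq A w w"
      by (simp add: sesq_linear c' c_def[symmetric] algebra_simps)
    also have "x * c = of_real (- t * (cmod c)\<^sup>2)"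
      unfolding x_def of_real_mult of_real_minus cc by (simp add: mult_ac)
    also have "cnj x * x = of_real (t\<^sup>2 * (cmod c)\<^sup>2)"
      unfolding x_def of_real_mult cc by (simp add: power2_eq_square mult_ac)
    also have "Re (sesq A u u + of_real (- t * (cmod c)\<^sup>2) + cnj (of_real (- t * (cmod c)\<^sup>2)) +
        of_real (t\<^sup>2 * (cmod c)\<^sup>2) * sesq A w w) = a - 2 * t * (cmod c)\<^sup>2 + t\<^sup>2 * (cmod c)\<^sup>2 * b"
      by (simp only: a_def b_def complex_cnj_complex_of_real plus_complex.sel times_complex.sel
          Re_complex_of_real Im_complex_of_real)
    finally show ?thesis .
  qed
  show ?thesis
  proof (cases "b = 0")
    case False
    \<comment> \<open>The quadratic is smallest at \<open>t = 1 / b\<close>.\<close>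
    then show ?thesis
      using quad[of "1 / b"] b unfolding a_def[symmetric] b_def[symmetric] c_def[symmetric]
      by (simp add: field_simps power2_eq_square)
  next
    case True
    have "c = 0"
    proof (rule ccontr)
      assume "c \<noteq> 0"
      \<comment> \<open>For \<open>b = 0\<close> the expression is affine in \<open>t\<close>, and
        this \<open>t\<close> gives it the value \<open>- 1\<close>.\<close>
      then show False
        using quad[of "(a + 1) / (2 * (cmod c)\<^sup>2)"] True by simp
    qed
    then show ?thesis
      using True by (simp add: b_def[symmetric] c_def[symmetric])
  qed
qed

section \<open>Tensor products and the reduction criterion\<close>

lemma sum_UNIV_prod:
  "(\<Sum>p\<in>(UNIV :: ('a::finite \<times> 'b::finite) set). f p) = (\<Sum>i\<in>UNIV. \<Sum>k\<in>UNIV. f (i, k))"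
  by (simp add: sum.cartesian_product flip: UNIV_Times_UNIV)

text \<open>Splits a bipartite vector into first-factor vectors, one per basis index of the second
  factor. A form for \<open>A \<otimes> B\<close> then pairs \<open>B\<close> with the Gram matrix
  of the slices under \<open>A\<close>.\<close>

definition slice :: "complex^('a::finite \<times> 'b::finite) \<Rightarrow> 'b \<Rightarrow> complex^'a" where
  "slice v k = (\<chi> i. v $ (i, k))"

lemma sesq_tensor:
  "sesq (A \<otimes> B) v v = (\<Sum>k\<in>UNIV. \<Sum>l\<in>UNIV. B $ k $ l * sesq A (slice v k) (slice v l))"
proof -
  have "sesq (A \<otimes> B) v v = (\<Sum>i\<in>UNIV. \<Sum>k\<in>UNIV. \<Sum>j\<in>UNIV. \<Sum>l\<in>UNIV.
      B $ k $ l * (cnj (v $ (i, k)) * A $ i $ j * v $ (j, l)))"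
    by (simp add: sesq_def tensor_def sum_UNIV_prod mult_ac)
  also have "\<dots> = (\<Sum>k\<in>UNIV. \<Sum>i\<in>UNIV. \<Sum>l\<in>UNIV. \<Sum>j\<in>UNIV.
      B $ k $ l * (cnj (v $ (i, k)) * A $ i $ j * v $ (j, l)))"
    by (subst sum.swap) (intro sum.cong refl sum.swap)
  also have "\<dots> = (\<Sum>k\<in>UNIV. \<Sum>l\<in>UNIV. \<Sum>i\<in>UNIV. \<Sum>j\<in>UNIV.
      B $ k $ l * (cnj (v $ (i, k)) * A $ i $ j * v $ (j, l)))"
    by (intro sum.cong refl sum.swap)
  finally show ?thesis
    by (simp add: sesq_def slice_def sum_distrib_left)
qed

lemma sesq_tensor_mat_1:
  "sesq (A \<otimes> mat 1) v v = (\<Sum>k\<in>UNIV. sesq A (slice v k) (slice v k))"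
  unfolding sesq_tensor
  by (simp add: mat_def if_distrib[of "\<lambda>x. x * _"] cong: if_cong)

lemma sum_norm_slice:
  "(\<Sum>k\<in>UNIV. \<Sum>i\<in>UNIV. (cmod (slice v k $ i))\<^sup>2) = (\<Sum>p\<in>UNIV. (cmod (v $ p))\<^sup>2)"
  unfolding sum_UNIV_prod slice_def by (subst sum.swap) simp

text \<open>For a qubit state \<open>\<tau>\<close> the complement \<open>mat 1 - \<tau>\<close> has diagonal entries
  \<open>\<tau>\<^sub>2\<^sub>2\<close>, \<open>\<tau>\<^sub>1\<^sub>1\<close> and off-diagonal entries \<open>- \<tau>\<^sub>1\<^sub>2\<close>, \<open>- \<tau>\<^sub>2\<^sub>1\<close>. So the claim pairs two positive
  \<open>2 \<times> 2\<close> matrices, which Cauchy--Schwarz for each of them and AM--GM settle.\<close>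

lemma product_state_le_tensor_mat_1:
  fixes \<sigma> :: "complex^'a^'a" and \<tau> :: "complex^2^2" and v :: "complex^('a::finite \<times> 2)"
  assumes "state \<sigma>" and "state \<tau>"
  shows "Re (sesq (\<sigma> \<otimes> \<tau>) v v) \<le> Re (sesq (\<sigma> \<otimes> mat 1) v v)"
proof -
  have psd: "pos_semidef \<sigma>" "pos_semidef \<tau>"
    using assms by (auto simp: state_def)
  define g where "g k l = sesq \<sigma> (slice v k) (slice v l)" for k l
  define t where "t k l = \<tau> $ k $ l" for k l
  have g21: "g 2 1 = cnj (g 1 2)"
    using sesq_cnj[of \<sigma>] psd by (simp add: g_def pos_semidef_def)
  have t21: "t 2 1 = cnj (t 1 2)"
    using sesq_cnj[of \<tau> "axis 1 1" "axis 2 1"] psd by (simp add: t_def pos_semidef_def sesq_axis)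
  have gCS: "(cmod (g 1 2))\<^sup>2 \<le> Re (g 1 1) * Re (g 2 2)"
    using pos_semidef_Cauchy_Schwarz[OF psd(1)] by (simp add: g_def)
  have tCS: "(cmod (t 1 2))\<^sup>2 \<le> Re (t 1 1) * Re (t 2 2)"
    using pos_semidef_Cauchy_Schwarz[OF psd(2), of "axis 1 1" "axis 2 1"] by (simp add: t_def sesq_axis)
  have g0: "0 \<le> Re (g k k)" for k
    using psd by (simp add: g_def pos_semidef_sesq)
  have t0: "0 \<le> Re (t k k)" for k
    using psd(2) unfolding pos_semidef_sesq t_def by (metis sesq_axis)
  have gim: "Im (g k k) = 0" for k
    using sesq_cnj[of \<sigma> "slice v k" "slice v k"] psd
    by (simp add: g_def pos_semidef_def complex_eq_iff)
  have tr: "Re (t 1 1) + Re (t 2 2) = 1"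
    using assms(2) by (auto simp: t_def state_def trace_def sum_2 complex_eq_iff)
  \<comment> \<open>The two off-diagonal terms are conjugate, so their sum is twice a real part.
    Squares are compared because Cauchy-Schwarz bounds squared moduli.\<close>
  have "(Re (t 1 2 * g 1 2 + t 2 1 * g 2 1))\<^sup>2 = (2 * Re (t 1 2 * g 1 2))\<^sup>2"
    by (simp add: g21 t21 algebra_simps)
  also have "\<dots> = 4 * (Re (t 1 2 * g 1 2))\<^sup>2"
    by (simp only: power_mult_distrib) simp
  also have "\<dots> \<le> 4 * (cmod (t 1 2 * g 1 2))\<^sup>2"
    by (simp add: cmod_power2)
  also have "\<dots> = 4 * ((cmod (t 1 2))\<^sup>2 * (cmod (g 1 2))\<^sup>2)"
    by (simp add: norm_mult power_mult_distrib)
  also have "\<dots> \<le> 4 * ((Re (t 1 1) * Re (t 2 2)) * (Re (g 1 1) * Re (g 2 2)))"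
    using gCS tCS by (intro mult_left_mono mult_mono) (auto simp: g0 t0)
  also have "\<dots> = 4 * ((Re (t 1 1) * Re (g 2 2)) * (Re (t 2 2) * Re (g 1 1)))"
    by (simp add: mult_ac)
  also have "\<dots> \<le> (Re (t 1 1) * Re (g 2 2) + Re (t 2 2) * Re (g 1 1))\<^sup>2"
    using zero_le_power2[of "Re (t 1 1) * Re (g 2 2) - Re (t 2 2) * Re (g 1 1)"]
    by (simp add: power2_eq_square algebra_simps)
  finally have "Re (t 1 2 * g 1 2 + t 2 1 * g 2 1) \<le> Re (t 1 1) * Re (g 2 2) + Re (t 2 2) * Re (g 1 1)"
    by (rule power2_le_imp_le) (simp add: g0 t0)
  moreover have "Re (sesq (\<sigma> \<otimes> \<tau>) v v) = Re (t 1 1) * Re (g 1 1) + Re (t 2 2) * Re (g 2 2)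
      + Re (t 1 2 * g 1 2 + t 2 1 * g 2 1)"
    by (simp add: sesq_tensor sum_2 gim flip: t_def g_def)
  \<comment> \<open>The trace of \<open>\<tau>\<close> enters as a factor 1, so that the terms
    \<open>t k k * g k k\<close> cancel and only the mixed products remain.\<close>
  moreover have "Re (sesq (\<sigma> \<otimes> mat 1) v v) = (Re (t 1 1) + Re (t 2 2)) * (Re (g 1 1) + Re (g 2 2))"
    by (simp only: sesq_tensor_mat_1 sum_2 tr flip: g_def) simp
  ultimately show ?thesis
    by (simp add: algebra_simps)
qed

lemma reduced1_tensor: "reduced1 (A \<otimes> B) = (\<chi> i j. trace B * A $ i $ j)"
  by (simp add: reduced1_def tensor_def trace_def sum_distrib_left mult.commute vec_eq_iff)

lemma reduced1_linear:
  "reduced1 (A + B) = reduced1 A + reduced1 B" "reduced1 (c *\<^sub>R A) = c *\<^sub>R reduced1 A"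
  by (simp_all add: reduced1_def vec_eq_iff sum.distrib scaleR_sum_right)

lemma tensor_linear_left:
  "(A + B) \<otimes> C = A \<otimes> C + B \<otimes> C" "(c *\<^sub>R A) \<otimes> C = c *\<^sub>R (A \<otimes> C)"
  by (simp_all add: tensor_def vec_eq_iff algebra_simps)

text \<open>Both sides are linear in \<open>\<rho>\<close>, so the inequality defines a convex set.
  It therefore suffices to treat product states, for which \<open>reduced1\<close> returns the first
  factor.\<close>

lemma reduction_criterion:
  fixes \<rho> :: "complex^('a::finite \<times> 2)^('a \<times> 2)"
  assumes "separable \<rho>"
  shows "Re (sesq \<rho> v v) \<le> Re (sesq (reduced1 \<rho> \<otimes> mat 1) v v)"
proof -
  let ?S = "{\<rho>. Re (sesq \<rho> v v) \<le> Re (sesq (reduced1 \<rho> \<otimes> mat 1) v v)}"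
  have "convex ?S"
    by (rule convexI)
      (auto simp: reduced1_linear tensor_linear_left sesq_add_matrix sesq_scaleR_matrix
        intro!: add_mono mult_left_mono)
  moreover have "{\<sigma> \<otimes> \<tau> |\<sigma> \<tau>. state \<sigma> \<and> state \<tau>} \<subseteq> ?S"
    by (auto simp: reduced1_tensor state_def intro!: product_state_le_tensor_mat_1)
  ultimately have "convex hull {\<sigma> \<otimes> \<tau> |\<sigma> \<tau>. state \<sigma> \<and> state \<tau>} \<subseteq> ?S"
    by (simp add: hull_minimal)
  then show ?thesis
    using assms by (auto simp: separable_def)
qed

section \<open>Unitary conjugation, traces and energies\<close>

lemma diag_conjugation:
  "(U ** A ** dagger U) $ i $ i = sesq A (\<chi> j. cnj (U $ i $ j)) (\<chi> j. cnj (U $ i $ j))"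
  unfolding sesq_def matrix_matrix_mult_def dagger_def
  by (simp add: sum_distrib_right) (rule sum.swap)

lemma unitary_row_norm:
  assumes "unitary U"
  shows "(\<Sum>j\<in>UNIV. (cmod (U $ i $ j))\<^sup>2) = 1"
proof -
  have "complex_of_real (\<Sum>j\<in>UNIV. (cmod (U $ i $ j))\<^sup>2) = (U ** dagger U) $ i $ i"
    by (simp add: matrix_matrix_mult_def dagger_def complex_norm_square del: of_real_power)
  also have "\<dots> = 1"
    using assms by (simp add: unitary_def mat_def)
  finally show ?thesis
    using of_real_eq_1_iff by blast
qed

lemma trace_conjugation:
  assumes "unitary U"
  shows "trace (U ** A ** dagger U) = trace A"
proof -
  have "trace (U ** A ** dagger U) = trace ((dagger U ** U) ** A)"
    by (subst trace_mul_sym) (simp only: matrix_mul_assoc)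
  then show ?thesis
    using assms by (simp add: unitary_def)
qed

lemma energy_total_hamiltonian:
  "energy (total_hamiltonian H1 H2) \<rho> = energy H1 (reduced1 \<rho>) + energy H2 (reduced2 \<rho>)"
proof -
  have 1: "trace (\<rho> ** (H1 \<otimes> mat 1)) = trace (reduced1 \<rho> ** H1)"
  proof -
    have "trace (\<rho> ** (H1 \<otimes> mat 1)) = (\<Sum>i\<in>UNIV. \<Sum>k\<in>UNIV. \<Sum>j\<in>UNIV. \<rho> $ (i, k) $ (j, k) * H1 $ j $ i)"
      by (simp add: trace_def matrix_matrix_mult_def tensor_def sum_UNIV_prod mat_def
          if_distrib[of "\<lambda>x. _ * x"] cong: if_cong)
    also have "\<dots> = (\<Sum>i\<in>UNIV. \<Sum>j\<in>UNIV. \<Sum>k\<in>UNIV. \<rho> $ (i, k) $ (j, k) * H1 $ j $ i)"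
      by (intro sum.cong refl sum.swap)
    finally show ?thesis
      by (simp add: trace_def matrix_matrix_mult_def reduced1_def sum_distrib_right)
  qed
  have 2: "trace (\<rho> ** (mat 1 \<otimes> H2)) = trace (reduced2 \<rho> ** H2)"
  proof -
    have "trace (\<rho> ** (mat 1 \<otimes> H2)) = (\<Sum>i\<in>UNIV. \<Sum>k\<in>UNIV. \<Sum>j\<in>UNIV. \<Sum>l\<in>UNIV.
        if j = i then \<rho> $ (i, k) $ (j, l) * H2 $ l $ k else 0)"
      by (simp add: trace_def matrix_matrix_mult_def tensor_def sum_UNIV_prod mat_def
          if_distrib[of "\<lambda>x. x * _"] if_distrib[of "\<lambda>x. _ * x"] cong: if_cong)
    also have "\<dots> = (\<Sum>i\<in>UNIV. \<Sum>k\<in>UNIV. \<Sum>l\<in>UNIV. \<Sum>j\<in>UNIV.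
        if j = i then \<rho> $ (i, k) $ (j, l) * H2 $ l $ k else 0)"
      by (intro sum.cong refl sum.swap)
    also have "\<dots> = (\<Sum>k\<in>UNIV. \<Sum>i\<in>UNIV. \<Sum>l\<in>UNIV. \<rho> $ (i, k) $ (i, l) * H2 $ l $ k)"
      by (simp, rule sum.swap)
    also have "\<dots> = (\<Sum>k\<in>UNIV. \<Sum>l\<in>UNIV. \<Sum>i\<in>UNIV. \<rho> $ (i, k) $ (i, l) * H2 $ l $ k)"
      by (intro sum.cong refl sum.swap)
    finally show ?thesis
      by (simp add: trace_def matrix_matrix_mult_def reduced2_def sum_distrib_right)
  qed
  show ?thesis
    by (simp add: energy_def total_hamiltonian_def matrix_add_ldistrib trace_add 1 2)
qed

lemma trace_reduced: "trace (reduced1 \<rho>) = trace \<rho>" "trace (reduced2 \<rho>) = trace \<rho>"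
  unfolding trace_def reduced1_def reduced2_def sum_UNIV_prod
  by (simp, simp, rule sum.swap)

text \<open>The excited level \<open>|1\<rangle>\<close> has index \<open>1\<close>; the ground level \<open>|0\<rangle>\<close> is written \<open>2\<close>, as \<open>0 = 2\<close> in type \<open>2\<close>.\<close>

lemma energy_qubit_hamiltonian:
  "energy (qubit_hamiltonian E \<alpha>) A = E * Re (trace A) + \<alpha> * Re (A $ 1 $ 1)"
  unfolding energy_def trace_def matrix_matrix_mult_def qubit_hamiltonian_def ketbra_def
  by (simp add: sum_2 algebra_simps)

text \<open>A minimizer of the energy for \<open>qubit_hamiltonian 0 1\<close> maximizes the ground-level population, and
  every unit vector occurs as the conjugated ground-level row of a unitary; no spectral theorem is needed.\<close>

lemma max_rayleigh_attained:
  fixes A :: "complex^2^2"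
  obtains U where "unitary U"
    and "\<And>v. Re (sesq A v v) \<le> Re ((U ** A ** dagger U) $ 2 $ 2) * (\<Sum>i\<in>UNIV. (cmod (v $ i))\<^sup>2)"
proof -
  have diag: "Re ((V ** A ** dagger V) $ 2 $ 2) = Re (trace A) - energy (qubit_hamiltonian 0 1) (V ** A ** dagger V)"
    if "unitary V" for V
    using arg_cong[OF trace_conjugation[OF that, of A], of Re]
    by (simp add: energy_qubit_hamiltonian trace_def sum_2)
  obtain U where U: "unitary U"
    "\<And>V. unitary V \<Longrightarrow> energy (qubit_hamiltonian 0 1) (U ** A ** dagger U)
        \<le> energy (qubit_hamiltonian 0 1) (V ** A ** dagger V)"
    using ergotropy_min_attained by blast
  show thesis
  proof (rule that[OF U(1)])
    fix v :: "complex^2"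
    define r where "r = sqrt (\<Sum>i\<in>UNIV. (cmod (v $ i))\<^sup>2)"
    have r2: "(\<Sum>i\<in>UNIV. (cmod (v $ i))\<^sup>2) = r\<^sup>2"
      by (simp add: r_def sum_nonneg)
    show "Re (sesq A v v) \<le> Re ((U ** A ** dagger U) $ 2 $ 2) * (\<Sum>i\<in>UNIV. (cmod (v $ i))\<^sup>2)"
    proof (cases "r = 0")
      case True
      then have "v = 0"
        by (simp add: r_def vec_eq_iff sum_nonneg_eq_0_iff)
      then show ?thesis
        by (simp add: sesq_def)
    next
      case False
      \<comment> \<open>The second row is the normalized conjugate of \<open>v\<close>, since
        \<open>diag_conjugation\<close> conjugates rows again; the first row is a unit vector
        orthogonal to it.\<close>
      define V :: "complex^2^2" where "V = (\<chi> i j. (if i = 2 then cnj (v $ j)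
          else if j = 2 then - v $ 1 else v $ 2) / of_real r)"
      have n: "v $ 1 * cnj (v $ 1) + v $ 2 * cnj (v $ 2) = of_real r * of_real r"
        using arg_cong[OF r2, of complex_of_real]
        by (simp add: sum_2 complex_norm_square[symmetric] power2_eq_square[of "complex_of_real r"])
      have "unitary V"
        using False n
        by (auto simp: unitary_def V_def matrix_matrix_mult_def dagger_def mat_def vec_eq_iff forall_2
            sum_2 mult_ac add.commute simp flip: add_divide_distrib diff_divide_distrib)
      then have le: "Re ((V ** A ** dagger V) $ 2 $ 2) \<le> Re ((U ** A ** dagger U) $ 2 $ 2)"
        using U diag by simp
      have w: "(\<chi> j. cnj (V $ 2 $ j)) = complex_of_real (1 / r) *s v"
        by (simp add: V_def vec_eq_iff)
      have "(V ** A ** dagger V) $ 2 $ 2 = complex_of_real (1 / r\<^sup>2) * sesq A v v"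
        unfolding diag_conjugation w sesq_linear by (simp add: power2_eq_square)
      then have "Re ((V ** A ** dagger V) $ 2 $ 2) = Re (sesq A v v) / r\<^sup>2"
        by (simp del: of_real_power)
      then show ?thesis
        using le False by (simp add: r2 pos_divide_le_eq)
    qed
  qed
qed

theorem proposition1:
  fixes E1 E2 \<alpha>1 \<alpha>2 :: real and \<rho> :: "complex^(2 \<times> 2)^(2 \<times> 2)"
  assumes "\<alpha>1 \<ge> 0" and "\<alpha>2 \<ge> 0"
    and "state \<rho>" and "separable \<rho>"
  shows "Delta12 (qubit_hamiltonian E1 \<alpha>1) (qubit_hamiltonian E2 \<alpha>2) \<rho>
           \<le> max ((\<alpha>1 - \<alpha>2) / 2) 0"
proof -
  let ?H1 = "qubit_hamiltonian E1 \<alpha>1" and ?H2 = "qubit_hamiltonian E2 \<alpha>2"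
  let ?H = "total_hamiltonian ?H1 ?H2"
  have tr: "trace \<rho> = 1" and psd: "pos_semidef \<rho>"
    using assms by (auto simp: state_def)
  obtain U where U: "unitary U"
    "ergotropy ?H \<rho> = energy ?H \<rho> - energy ?H (U ** \<rho> ** dagger U)"
    using ergotropy_min_attained by blast
  obtain U1 where U1: "unitary U1"
    "\<And>V. unitary V \<Longrightarrow> energy ?H1 (U1 ** reduced1 \<rho> ** dagger U1) \<le> energy ?H1 (V ** reduced1 \<rho> ** dagger V)"
    "ergotropy ?H1 (reduced1 \<rho>) = energy ?H1 (reduced1 \<rho>) - energy ?H1 (U1 ** reduced1 \<rho> ** dagger U1)"
    using ergotropy_min_attained by blast
  \<comment> \<open>\<open>V\<close> is kept apart from \<open>U1\<close>: for
    \<open>\<alpha>1 = 0\<close> every unitary minimizes the energy for \<open>?H1\<close>, so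
    \<open>U1\<close> need not maximize the ground-level population.\<close>
  obtain V where V: "unitary V"
    "\<And>v. Re (sesq (reduced1 \<rho>) v v) \<le> Re ((V ** reduced1 \<rho> ** dagger V) $ 2 $ 2) * (\<Sum>i\<in>UNIV. (cmod (v $ i))\<^sup>2)"
    using max_rayleigh_attained by blast
  define p where "p = Re ((V ** reduced1 \<rho> ** dagger V) $ 2 $ 2)"
  define d where "d i k = Re ((U ** \<rho> ** dagger U) $ (i, k) $ (i, k))" for i k
  \<comment> \<open>\<open>d i k\<close> is the value of the form of \<open>\<rho>\<close> at a
    conjugated row of \<open>U\<close>. The slices of this unit vector share its squared norm 1, so
    their bounds by \<open>p\<close> add up to \<open>p\<close>.\<close>
  have d_le: "d i k \<le> p" for i k
  proof -
    let ?v = "\<chi> j. cnj (U $ (i, k) $ j)"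
    have "d i k = Re (sesq \<rho> ?v ?v)"
      unfolding d_def diag_conjugation ..
    also have "\<dots> \<le> (\<Sum>l\<in>UNIV. Re (sesq (reduced1 \<rho>) (slice ?v l) (slice ?v l)))"
      using reduction_criterion[OF assms(4), of ?v] by (simp add: sesq_tensor_mat_1)
    also have "\<dots> \<le> (\<Sum>l\<in>UNIV. p * (\<Sum>j\<in>UNIV. (cmod (slice ?v l $ j))\<^sup>2))"
      unfolding p_def by (intro sum_mono V(2))
    also have "\<dots> = p * (\<Sum>j\<in>UNIV. (cmod (?v $ j))\<^sup>2)"
      by (simp only: sum_norm_slice flip: sum_distrib_left)
    also have "\<dots> = p"
      using unitary_row_norm[OF U(1), of "(i, k)"] by simp
    finally show ?thesis .
  qed
  have d_nonneg: "0 \<le> d i k" for i k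
    using psd unfolding d_def diag_conjugation by (simp add: pos_semidef_sesq)
  have d_sum: "d 1 1 + d 1 2 + d 2 1 + d 2 2 = 1"
    using arg_cong[OF trace_conjugation[OF U(1), of \<rho>, unfolded tr], of Re]
    by (simp add: d_def trace_def sum_UNIV_prod sum_2)
  \<comment> \<open>\<open>V\<close> is one competitor of \<open>U1\<close>, which bounds the
    minimal local energy from above, the direction needed.\<close>
  have "energy ?H1 (V ** reduced1 \<rho> ** dagger V) = E1 + \<alpha>1 * (1 - p)"
    using arg_cong[OF trace_conjugation[OF V(1), of "reduced1 \<rho>"], of Re]
    by (simp add: energy_qubit_hamiltonian trace_reduced tr p_def)
      (simp add: trace_def sum_2 algebra_simps)
  then have E1: "energy ?H1 (U1 ** reduced1 \<rho> ** dagger U1) \<le> E1 + \<alpha>1 * (1 - p)"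
    using U1(2)[OF V(1)] by simp
  have E: "energy ?H (U ** \<rho> ** dagger U) = E1 + \<alpha>1 * (d 1 1 + d 1 2) + E2 + \<alpha>2 * (d 1 1 + d 2 1)"
    by (simp add: energy_total_hamiltonian energy_qubit_hamiltonian trace_reduced
        trace_conjugation[OF U(1)] tr)
      (simp add: reduced1_def reduced2_def sum_2 d_def)
  \<comment> \<open>The energies of \<open>\<rho>\<close> and of its reductions cancel, leaving the
    two minimal energies and the ground energy.\<close>
  have "Delta12 ?H1 ?H2 \<rho> \<le> \<alpha>1 * (1 - p) - \<alpha>1 * (d 1 1 + d 1 2) - \<alpha>2 * (d 1 1 + d 2 1)"
    using E1 unfolding Delta12_def U(2) U1(3) E ground_energy_qubit_hamiltonian[OF assms(2)]
    by (simp add: energy_total_hamiltonian algebra_simps)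
  also have "\<dots> \<le> max ((\<alpha>1 - \<alpha>2) / 2) 0"
  proof (cases "\<alpha>1 \<le> \<alpha>2")
    case True
    have "\<alpha>1 * (1 - p) \<le> \<alpha>1 * (d 1 1 + d 1 2 + d 2 1)"
      using d_le[of 2 2] d_sum assms(1) by (intro mult_left_mono) auto
    moreover have "\<alpha>1 * d 2 1 \<le> \<alpha>2 * d 2 1" "0 \<le> \<alpha>2 * d 1 1"
      using True d_nonneg assms(2) by (auto intro: mult_right_mono)
    ultimately show ?thesis
      by (simp add: algebra_simps)
  next
    case False
    define b where "b = min (d 2 1) (d 2 2)"
    have "\<alpha>1 * (1 - p) \<le> \<alpha>1 * (1 - max (d 2 1) (d 2 2))"
      using d_le assms(1) by (intro mult_left_mono) auto
    also have "1 - max (d 2 1) (d 2 2) = d 1 1 + d 1 2 + b"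
      using d_sum by (simp add: b_def)
    finally have "\<alpha>1 * (1 - p) \<le> \<alpha>1 * (d 1 1 + d 1 2) + \<alpha>1 * b"
      by (simp add: algebra_simps)
    \<comment> \<open>Lowering \<open>d 2 1\<close> to \<open>b\<close> lets the
      \<open>\<alpha>2\<close> term merge with \<open>\<alpha>1 * b\<close> into
      \<open>(\<alpha>1 - \<alpha>2) * b\<close>.\<close>
    moreover have "\<alpha>2 * b \<le> \<alpha>2 * d 2 1" "0 \<le> \<alpha>2 * d 1 1"
      using assms(2) d_nonneg by (auto simp: b_def intro: mult_left_mono)
    moreover have "(\<alpha>1 - \<alpha>2) * b \<le> (\<alpha>1 - \<alpha>2) * (1 / 2)"
      using False d_sum d_nonneg[of 1 1] d_nonneg[of 1 2]
      by (intro mult_left_mono) (auto simp: b_def)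
    ultimately have "\<alpha>1 * (1 - p) - \<alpha>1 * (d 1 1 + d 1 2) - \<alpha>2 * (d 1 1 + d 2 1) \<le> (\<alpha>1 - \<alpha>2) / 2"
      by (simp add: algebra_simps)
    then show ?thesis
      by (rule max.coboundedI1)
  qed
  finally show ?thesis .
qed

end
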